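(* Suppose $0<1/n\ll\theta\ll\epsilon\ll 1$, and $H$ is a $3$-graph on a set $X$ of $n$ vertices that does not contain a Fano plane and has $\delta_2(H)>(1/2-\theta)n$. Then there is $Z\subseteq X$ with $|Z|>(1/2-\epsilon)n$ that spans at most $\epsilon|Z|^3/6$ edges of $H$.
   Context: Hierarchy convention: "$0<\alpha\ll\beta$" means there is an increasing function $f$ such that the statement holds whenever $0<\alpha<f(\beta)$; chains are read right to left. For a $3$-graph $H$ and $S\subseteq V(H)$, $N_H(S)=\{T\subseteq V(H)\setminus S: S\cup T\in E(H)\}$ and $\delta_2(H)=\min_{|S|=2}|N_H(S)|$. The Fano plane is the $3$-graph on the $7$ nonzero vectors of $\mathbb{F}_2^3$ whose edges are the triples $\{a,b,c\}$ with $a+b=c$; "contains" means as a (not necessarily induced) subgraph. *)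

theory Defs
  imports Complex_Main
begin

type_synonym fano_pt = "bool \<times> bool \<times> bool"

fun f2_add :: "fano_pt \<Rightarrow> fano_pt \<Rightarrow> fano_pt" where
  "f2_add (a1, a2, a3) (b1, b2, b3) = (a1 \<noteq> b1, a2 \<noteq> b2, a3 \<noteq> b3)"

definition fano_vertices :: "fano_pt set" where
  "fano_vertices = UNIV - {(False, False, False)}"

definition fano_edges :: "fano_pt set set" where
  "fano_edges = {{a, b, c} | a b c. a \<in> fano_vertices \<and> b \<in> fano_vertices \<and>
      c \<in> fano_vertices \<and> f2_add a b = c}"

definition is_3graph :: "'a set \<Rightarrow> 'a set set \<Rightarrow> bool" where
  "is_3graph X E \<longleftrightarrow> (\<forall>e\<in>E. e \<subseteq> X \<and> card e = 3)"

definition contains_fano :: "'a set \<Rightarrow> 'a set set \<Rightarrow> bool" where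
  "contains_fano X E \<longleftrightarrow> (\<exists>f. inj_on f fano_vertices \<and> f ` fano_vertices \<subseteq> X \<and>
      (\<forall>e\<in>fano_edges. f ` e \<in> E))"

definition nbhd :: "'a set \<Rightarrow> 'a set set \<Rightarrow> 'a set \<Rightarrow> 'a set set" where
  "nbhd X E S = {T. T \<subseteq> X - S \<and> S \<union> T \<in> E}"

text \<open>Minimum codegree delta_2(H) (for |X| \<ge> 2).\<close>
definition min_codegree :: "'a set \<Rightarrow> 'a set set \<Rightarrow> nat" where
  "min_codegree X E = Min {card (nbhd X E S) | S. S \<subseteq> X \<and> card S = 2}"

definition spanned_edges :: "'a set set \<Rightarrow> 'a set \<Rightarrow> nat" where
  "spanned_edges E Z = card {e \<in> E. e \<subseteq> Z}"

end

theory Submission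
  imports Defs "HOL-Analysis.Convex"
begin

text \<open>
  Sample a bounded number of vertices of \<open>H\<close>. A positive fraction of the samples induces the same \<open>3\<close>-graph
  \<open>G\<close> on the index set \<open>K\<close>, so the Cauchy--Schwarz (box) argument gives pairs
  \<open>{\<phi> k, \<psi> k}\<close>, \<open>k \<in> K\<close>, such that every choice of representatives again induces \<open>G\<close>.
  If \<open>v\<close> is joined to all three pairs of an edge of \<open>G\<close>, then \<open>v\<close> and these pairs span a Fano plane;
  hence each \<open>v\<close> determines an independent set \<open>{k. v \<in> N(\<phi> k, \<psi> k)}\<close> of \<open>G\<close>, and averaging the
  codegrees over \<open>v\<close> yields one of size at least \<open>(1/2 - \<theta>) card K\<close>.

  On the other hand, an independent set containing the sampled vertices \<open>a\<close>, \<open>b\<close> avoids \<open>N(a, b)\<close>.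
  If every set of almost \<open>n/2\<close> vertices spanned many edges, then either \<open>N(a, b)\<close> would be
  substantially larger than \<open>n/2\<close>, or its complement would span many edges. Grouping the sample into
  random triples, a Chernoff bound and a union bound over the pairs \<open>a\<close>, \<open>b\<close> show that
  in most samples every independent set is then smaller than \<open>(1/2 - \<theta>) card K\<close>.
\<close>

section \<open>Chernoff bounds in counting form\<close>

text \<open>Exponential moment method: the entries of a uniform function from \<open>J\<close> to
  \<open>Y\<close> are independent, so the moment of the sum is a power of the moment of one entry.
  Only an upper bound \<open>\<mu>\<close> on the mean enters, which suits the one-sided
  conclusion.\<close>

lemma chernoff_count:
  fixes f :: "'b \<Rightarrow> real" and \<mu> \<delta> :: real
  assumes J: "finite J" and Y: "finite Y"
    and f: "\<And>y. y \<in> Y \<Longrightarrow> 0 \<le> f y \<and> f y \<le> 1"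
    and mean: "sum f Y \<le> \<mu> * card Y"
    and \<delta>: "0 \<le> \<delta>" "\<delta> \<le> 1"
  shows "real (card {\<Phi> \<in> J \<rightarrow>\<^sub>E Y. (\<mu> + \<delta>) * card J \<le> (\<Sum>s\<in>J. f (\<Phi> s))})
         \<le> exp (- (\<delta>\<^sup>2 / 4) * card J) * real (card Y) ^ card J"
proof -
  \<comment> \<open>As \<open>exp u \<le> 1 + u + u\<^sup>2\<close> for \<open>u\<close> in the unit
    interval, each entry contributes the exponent \<open>l\<^sup>2 - l * \<delta>\<close>; this
    \<open>l\<close> minimises it, with value \<open>- \<delta>\<^sup>2 / 4\<close>.\<close>
  define l where "l = \<delta> / 2"
  have l: "0 \<le> l" "l \<le> 1" using \<delta> by (auto simp: l_def)
  let ?A = "{\<Phi> \<in> J \<rightarrow>\<^sub>E Y. (\<mu> + \<delta>) * card J \<le> (\<Sum>s\<in>J. f (\<Phi> s))}"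
  have fin: "finite (J \<rightarrow>\<^sub>E Y)" using J Y by (simp add: finite_PiE)
  have "(\<Sum>y\<in>Y. exp (l * f y)) \<le> (\<Sum>y\<in>Y. 1 + l * f y + l\<^sup>2)"
  proof (rule sum_mono)
    fix y assume "y \<in> Y"
    then have fy: "0 \<le> f y" "f y \<le> 1" using f by auto
    then have "l * f y \<le> 1" using l by (simp add: mult_le_one)
    then have "exp (l * f y) \<le> 1 + l * f y + (l * f y)\<^sup>2"
      using fy l by (intro exp_bound) auto
    moreover have "(l * f y)\<^sup>2 \<le> l\<^sup>2"
      using fy l by (intro power_mono) (auto simp: mult_left_le)
    ultimately show "exp (l * f y) \<le> 1 + l * f y + l\<^sup>2" by linarith
  qed
  also have "\<dots> = card Y + l * sum f Y + l\<^sup>2 * card Y"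
    by (simp add: sum.distrib sum_distrib_left)
  also have "\<dots> \<le> card Y + l * (\<mu> * card Y) + l\<^sup>2 * card Y"
    using mean l by (simp add: mult_left_mono)
  also have "\<dots> = card Y * (1 + (l * \<mu> + l\<^sup>2))" by (simp add: algebra_simps)
  also have "\<dots> \<le> card Y * exp (l * \<mu> + l\<^sup>2)"
    by (intro mult_left_mono exp_ge_add_one_self) auto
  finally have mgf: "(\<Sum>y\<in>Y. exp (l * f y)) \<le> card Y * exp (l * \<mu> + l\<^sup>2)" .
  have "real (card ?A) = (\<Sum>\<Phi>\<in>?A. 1)" by simp
  \<comment> \<open>Markov's inequality: the exponent is nonnegative on the counted set.\<close>
  also have "\<dots> \<le> (\<Sum>\<Phi>\<in>?A. exp (l * ((\<Sum>s\<in>J. f (\<Phi> s)) - (\<mu> + \<delta>) * card J)))"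
    using l by (intro sum_mono) auto
  also have "\<dots> \<le> (\<Sum>\<Phi>\<in>J \<rightarrow>\<^sub>E Y. exp (l * ((\<Sum>s\<in>J. f (\<Phi> s)) - (\<mu> + \<delta>) * card J)))"
    using fin by (intro sum_mono2) auto
  also have "\<dots> = (\<Sum>\<Phi>\<in>J \<rightarrow>\<^sub>E Y. (\<Prod>s\<in>J. exp (l * f (\<Phi> s)))) * exp (- (l * (\<mu> + \<delta>) * card J))"
    using J by (simp add: sum_distrib_right sum_distrib_left exp_sum right_diff_distrib
        flip: exp_add mult.assoc) (simp add: exp_diff exp_minus divide_inverse exp_sum sum_distrib_left J mult.assoc)
  \<comment> \<open>Independence: a sum over functions of a product over entries is a product of
    sums.\<close>
  also have "\<dots> = (\<Sum>y\<in>Y. exp (l * f y)) ^ card J * exp (- (l * (\<mu> + \<delta>) * card J))"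
    using J Y prod_sum_PiE[of J "\<lambda>_. Y" "\<lambda>_ y. exp (l * f y)"] by simp
  also have "\<dots> \<le> (card Y * exp (l * \<mu> + l\<^sup>2)) ^ card J * exp (- (l * (\<mu> + \<delta>) * card J))"
    by (intro mult_right_mono power_mono mgf sum_nonneg) auto
  also have "\<dots> = exp (card J * (l * \<mu> + l\<^sup>2) - (l * (\<mu> + \<delta>) * card J)) * real (card Y) ^ card J"
    by (simp add: power_mult_distrib exp_diff exp_minus exp_of_nat_mult divide_inverse)
  also have "card J * (l * \<mu> + l\<^sup>2) - (l * (\<mu> + \<delta>) * card J) = - (\<delta>\<^sup>2 / 4) * card J"
    by (simp add: l_def power2_eq_square field_simps)
  finally show ?thesis .
qed

text \<open>The weight \<open>F\<close> depends on two entries of the sample itself. Once these are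
  fixed, the other \<open>card J - 2\<close> entries are still independent and
  \<open>chernoff_count\<close> applies to them; \<open>R\<close> selects the seeds for which the
  mean is controlled.\<close>

lemma chernoff_count_seeded:
  fixes F :: "'b \<Rightarrow> 'b \<Rightarrow> 'b \<Rightarrow> real" and \<mu> \<delta> :: real
  assumes J: "finite J" and Y: "finite Y" and t: "t \<in> J" "t' \<in> J" "t \<noteq> t'"
    and F: "\<And>y y' z. z \<in> Y \<Longrightarrow> 0 \<le> F y y' z \<and> F y y' z \<le> 1"
    and mean: "\<And>y y'. y \<in> Y \<Longrightarrow> y' \<in> Y \<Longrightarrow> R y y' \<Longrightarrow> sum (F y y') Y \<le> \<mu> * card Y"
    and \<delta>: "0 \<le> \<delta>" "\<delta> \<le> 1"
  shows "real (card {\<Phi> \<in> J \<rightarrow>\<^sub>E Y. R (\<Phi> t) (\<Phi> t') \<and>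
            (\<mu> + \<delta>) * real (card J - 2) \<le> (\<Sum>s\<in>J - {t, t'}. F (\<Phi> t) (\<Phi> t') (\<Phi> s))})
         \<le> exp (- (\<delta>\<^sup>2 / 4) * real (card J - 2)) * real (card Y) ^ card J" (is "real (card ?A) \<le> _")
proof -
  define J' where "J' = J - {t, t'}"
  have J': "finite J'" "card J' = card J - 2"
    using J t by (auto simp: J'_def card_Diff_subset)
  have "card {t, t'} \<le> card J" using J t by (intro card_mono) auto
  then have J2: "card J = card J' + 2" using t J' by simp
  let ?B = "\<lambda>y y'. {\<Phi> \<in> J' \<rightarrow>\<^sub>E Y. (\<mu> + \<delta>) * card J' \<le> (\<Sum>s\<in>J'. F y y' (\<Phi> s))}"
  let ?T = "SIGMA p : {p \<in> Y \<times> Y. R (fst p) (snd p)}. ?B (fst p) (snd p)"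
  let ?h = "\<lambda>\<Phi>. ((\<Phi> t, \<Phi> t'), restrict \<Phi> J')"
  have finB: "finite (?B y y')" for y y'
    using J' Y by (intro finite_subset[OF _ finite_PiE[of J' "\<lambda>_. Y"]]) auto
  have finT: "finite ?T" using Y finB by (intro finite_SigmaI) auto
  have "inj_on ?h ?A"
  proof (rule inj_onI)
    fix \<Phi> \<Psi> assume A: "\<Phi> \<in> ?A" "\<Psi> \<in> ?A" and eq: "?h \<Phi> = ?h \<Psi>"
    have "\<Phi> s = \<Psi> s" if "s \<in> J" for s
    proof (cases "s \<in> J'")
      case True
      then show ?thesis using eq by (metis prod.inject restrict_apply')
    next
      case False
      then show ?thesis using eq that by (auto simp: J'_def)
    qed
    then show "\<Phi> = \<Psi>" using A by (intro PiE_ext[of \<Phi> J "\<lambda>_. Y" \<Psi>]) auto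
  qed
  moreover have "?h ` ?A \<subseteq> ?T"
    using t by (auto simp: J'_def[symmetric] J'(2) PiE_mem) (auto simp: J'_def)
  ultimately have "card ?A \<le> card ?T" using finT by (rule card_inj_on_le)
  also have "card ?T = (\<Sum>p\<in>{p \<in> Y \<times> Y. R (fst p) (snd p)}. card (?B (fst p) (snd p)))"
    using Y finB by (intro card_SigmaI) auto
  finally have "real (card ?A) \<le> (\<Sum>p\<in>{p \<in> Y \<times> Y. R (fst p) (snd p)}. real (card (?B (fst p) (snd p))))"
    by (simp flip: of_nat_sum)
  also have "\<dots> \<le> (\<Sum>p\<in>{p \<in> Y \<times> Y. R (fst p) (snd p)}.
      exp (- (\<delta>\<^sup>2 / 4) * card J') * real (card Y) ^ card J')"
    using J' Y F mean \<delta> by (intro sum_mono chernoff_count) auto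
  \<comment> \<open>Summing over all pairs of seeds restores the two missing factors
    \<open>card Y\<close>.\<close>
  also have "\<dots> \<le> (\<Sum>p\<in>Y \<times> Y. exp (- (\<delta>\<^sup>2 / 4) * card J') * real (card Y) ^ card J')"
    using Y by (intro sum_mono2) auto
  also have "\<dots> = exp (- (\<delta>\<^sup>2 / 4) * card J') * real (card Y) ^ card J"
    by (simp add: J2 card_cartesian_product power2_eq_square power_add)
  finally show ?thesis by (simp add: J'(2))
qed

section \<open>Doubled tuples in dense families\<close>

lemma card_PiE_insert_eq_sum:
  assumes "finite K" "finite X" "k \<notin> K" "S \<subseteq> insert k K \<rightarrow>\<^sub>E X"
  shows "card S = (\<Sum>\<phi>\<in>K \<rightarrow>\<^sub>E X. card {x \<in> X. \<phi>(k := x) \<in> S})"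
proof -
  let ?T = "SIGMA \<phi> : (K \<rightarrow>\<^sub>E X). {x \<in> X. \<phi>(k := x) \<in> S}"
  have "S = (\<lambda>(\<phi>, x). \<phi>(k := x)) ` ?T"
  proof (intro equalityI subsetI)
    fix f assume f: "f \<in> S"
    then have fX: "f \<in> insert k K \<rightarrow>\<^sub>E X" using assms by auto
    \<comment> \<open>Resetting \<open>k\<close> to \<open>undefined\<close> makes the function
      extensional on \<open>K\<close>.\<close>
    have "f(k := undefined) \<in> K \<rightarrow>\<^sub>E X"
      using fX assms(3) by (auto simp: PiE_def extensional_def)
    then have "(f(k := undefined), f k) \<in> ?T" using f fX by auto
    then show "f \<in> (\<lambda>(\<phi>, x). \<phi>(k := x)) ` ?T" by (rule rev_image_eqI) auto
  qed auto
  then have "card S = card ((\<lambda>(\<phi>, x). \<phi>(k := x)) ` ?T)" by simp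
  also have "\<dots> = card ?T"
  proof (rule card_image)
    show "inj_on (\<lambda>(\<phi>, x). \<phi>(k := x)) ?T"
    proof (rule inj_onI, clarsimp)
      fix \<phi> x \<psi> y assume *: "\<phi> \<in> K \<rightarrow>\<^sub>E X" "\<psi> \<in> K \<rightarrow>\<^sub>E X" "\<phi>(k := x) = \<psi>(k := y)"
      have "\<phi> j = \<psi> j" if "j \<in> K" for j
        using fun_cong[OF *(3), of j] that assms(3) by (auto split: if_splits)
      then show "\<phi> = \<psi> \<and> x = y"
        using *(1,2) fun_cong[OF *(3), of k] by (auto intro: PiE_ext)
    qed
  qed
  also have "\<dots> = (\<Sum>\<phi>\<in>K \<rightarrow>\<^sub>E X. card {x \<in> X. \<phi>(k := x) \<in> S})"
    using assms by (intro card_SigmaI) (auto simp: finite_PiE)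
  finally show ?thesis .
qed

text \<open>By Cauchy-Schwarz over the fibres, the families common to \<open>x\<close> and
  \<open>y\<close> have total size at least \<open>d\<^sup>2 * n\<^sup>2 * N\<close> over all
  ordered pairs. The diagonal accounts for at most \<open>n * N\<close>, less than half of this by
  \<open>large\<close>, so some pair of distinct points does at least half as well as the
  average.\<close>

lemma dense_imp_common_link_dense:
  fixes d :: real
  assumes K: "finite K" and X: "finite X" and k: "k \<notin> K" and S: "S \<subseteq> insert k K \<rightarrow>\<^sub>E X"
    and d: "0 < d" and dense: "d * real (card X) ^ card (insert k K) \<le> card S" and large: "2 / d\<^sup>2 < card X"
  obtains x y where "x \<in> X" "y \<in> X" "x \<noteq> y"
    "d\<^sup>2 / 2 * real (card X) ^ card K \<le> card {\<phi> \<in> K \<rightarrow>\<^sub>E X. \<phi>(k := x) \<in> S \<and> \<phi>(k := y) \<in> S}"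
proof -
  define T where "T x y = {\<phi> \<in> K \<rightarrow>\<^sub>E X. \<phi>(k := x) \<in> S \<and> \<phi>(k := y) \<in> S}" for x y
  define D where "D \<phi> = {x \<in> X. \<phi>(k := x) \<in> S}" for \<phi>
  define n where "n = real (card X)"
  define N where "N = real (card (K \<rightarrow>\<^sub>E X))"
  have fin: "finite (K \<rightarrow>\<^sub>E X)" using K X by (simp add: finite_PiE)
  have N: "N = n ^ card K" using K by (simp add: N_def n_def card_PiE)
  have n: "0 < n" using large d by (smt (verit) n_def divide_pos_pos zero_less_power)
  have Npos: "0 < N" using N n by simp
  have finD: "finite (D \<phi>)" for \<phi> using X by (simp add: D_def)
  have "d * (n * N) \<le> card S" using dense K k by (simp add: N n_def)
  also have "real (card S) = (\<Sum>\<phi>\<in>K \<rightarrow>\<^sub>E X. real (card (D \<phi>)))"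
    using card_PiE_insert_eq_sum[OF K X k S] by (simp add: D_def)
  finally have "(d * (n * N))\<^sup>2 \<le> (\<Sum>\<phi>\<in>K \<rightarrow>\<^sub>E X. real (card (D \<phi>)))\<^sup>2"
    using d n Npos by (intro power_mono) auto
  also have "\<dots> \<le> (\<Sum>\<phi>\<in>K \<rightarrow>\<^sub>E X. (real (card (D \<phi>)))\<^sup>2) * N"
    unfolding N_def by (rule sum_squared_le_sum_of_squares)
  \<comment> \<open>The square of a fibre size counts the ordered pairs in the fibre; exchanging the
    sums groups them by pair.\<close>
  also have "(\<Sum>\<phi>\<in>K \<rightarrow>\<^sub>E X. (real (card (D \<phi>)))\<^sup>2) = (\<Sum>\<phi>\<in>K \<rightarrow>\<^sub>E X. \<Sum>p\<in>X \<times> X. if p \<in> D \<phi> \<times> D \<phi> then 1 else 0)"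
  proof (rule sum.cong[OF refl])
    fix \<phi>
    have "D \<phi> \<times> D \<phi> = {p \<in> X \<times> X. p \<in> D \<phi> \<times> D \<phi>}" by (auto simp: D_def)
    then show "(real (card (D \<phi>)))\<^sup>2 = (\<Sum>p\<in>X \<times> X. if p \<in> D \<phi> \<times> D \<phi> then 1 else 0)"
      using X by (simp add: sum.If_cases power2_eq_square card_cartesian_product[symmetric] Int_def
          flip: of_nat_mult)
  qed
  also have "\<dots> = (\<Sum>p\<in>X \<times> X. real (card (T (fst p) (snd p))))"
    unfolding sum.swap[of _ "X \<times> X"]
  proof (rule sum.cong[OF refl])
    fix p assume "p \<in> X \<times> X"
    then have "T (fst p) (snd p) = {\<phi> \<in> K \<rightarrow>\<^sub>E X. p \<in> D \<phi> \<times> D \<phi>}" by (auto simp: T_def D_def)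
    then show "(\<Sum>\<phi>\<in>K \<rightarrow>\<^sub>E X. if p \<in> D \<phi> \<times> D \<phi> then 1 else 0) = real (card (T (fst p) (snd p)))"
      using fin by (simp add: sum.If_cases Int_def)
  qed
  finally have "d\<^sup>2 * n\<^sup>2 * N * N \<le> (\<Sum>p\<in>X \<times> X. real (card (T (fst p) (snd p)))) * N"
    by (simp add: power2_eq_square mult_ac)
  then have lower: "d\<^sup>2 * n\<^sup>2 * N \<le> (\<Sum>p\<in>X \<times> X. real (card (T (fst p) (snd p))))"
    using Npos by simp
  have "\<exists>x\<in>X. \<exists>y\<in>X. x \<noteq> y \<and> d\<^sup>2 / 2 * N \<le> card (T x y)"
  proof (rule ccontr)
    assume neg: "\<not> ?thesis"
    have "real (card (T (fst p) (snd p))) \<le> d\<^sup>2 / 2 * N + (if fst p = snd p then N else 0)"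
      if "p \<in> X \<times> X" for p
    proof (cases "fst p = snd p")
      case True
      have "card (T (fst p) (snd p)) \<le> card (K \<rightarrow>\<^sub>E X)" using fin by (intro card_mono) (auto simp: T_def)
      moreover have "0 \<le> d\<^sup>2 / 2 * N" using Npos by simp
      ultimately have "real (card (T (fst p) (snd p))) \<le> d\<^sup>2 / 2 * N + N" unfolding N_def by linarith
      then show ?thesis using True by simp
    next
      case False
      then show ?thesis using neg that by (cases p) (fastforce simp: not_le)
    qed
    then have "(\<Sum>p\<in>X \<times> X. real (card (T (fst p) (snd p))))
      \<le> (\<Sum>p\<in>X \<times> X. d\<^sup>2 / 2 * N + (if fst p = snd p then N else 0))" by (rule sum_mono)
    also have "\<dots> = n\<^sup>2 * (d\<^sup>2 / 2 * N) + n * N"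
    proof -
      have "{p \<in> X \<times> X. fst p = snd p} = (\<lambda>x. (x, x)) ` X" by auto
      then have "card {p \<in> X \<times> X. fst p = snd p} = card X" by (simp add: card_image inj_on_def)
      then show ?thesis
        using X by (simp add: sum.distrib sum.If_cases Int_def n_def card_cartesian_product power2_eq_square)
    qed
    also have "n * N < n\<^sup>2 * (d\<^sup>2 / 2 * N)"
    proof -
      have "2 < n * d\<^sup>2" using large d by (simp add: n_def field_simps)
      then have "(n * N) * 2 < (n * N) * (n * d\<^sup>2)" using n Npos by (intro mult_strict_left_mono) auto
      then show ?thesis by (simp add: power2_eq_square mult_ac)
    qed
    finally show False using lower by (simp add: mult_ac)
  qed
  then show ?thesis using that by (auto simp: T_def N n_def)
qed

text \<open>Induction on \<open>K\<close>: two values are chosen for the new coordinate, and the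
  induction hypothesis is applied to the tuples that extend into \<open>S\<close> by both. Each
  coordinate lowers the density from \<open>d\<close> to \<open>d\<^sup>2 / 2\<close>, so the
  threshold depends only on \<open>K\<close> and \<open>d\<close>.\<close>

lemma dense_imp_doubled_tuple:
  fixes d :: real and K :: "'k set"
  assumes "finite K" and "0 < d"
  shows "\<exists>n0. \<forall>(X :: 'a set) S. finite X \<and> n0 \<le> card X \<and> S \<subseteq> K \<rightarrow>\<^sub>E X \<and> d * real (card X) ^ card K \<le> card S
    \<longrightarrow> (\<exists>\<phi> \<psi>. (\<forall>k\<in>K. \<phi> k \<in> X \<and> \<psi> k \<in> X \<and> \<phi> k \<noteq> \<psi> k) \<and>
          (\<forall>A. (\<lambda>k\<in>K. if k \<in> A then \<phi> k else \<psi> k) \<in> S))"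
  using assms
proof (induction K arbitrary: d rule: finite_induct)
  case empty
  \<comment> \<open>With no coordinates there is a single extensional function, and positive density
    puts it into \<open>S\<close>.\<close>
  have "(\<lambda>k. undefined) \<in> S" if "S \<subseteq> {} \<rightarrow>\<^sub>E X" "d * real (card X) ^ card {} \<le> card S" for X :: "'a set" and S
  proof -
    have "S \<noteq> {}" using that empty by auto
    then show ?thesis using that(1) by auto
  qed
  then show ?case by (auto simp: restrict_def)
next
  case (insert k K)
  have d2: "0 < d\<^sup>2 / 2" using insert.prems by simp
  from insert.IH[OF d2] obtain n1 where n1: "\<forall>(X :: 'a set) S. finite X \<and> n1 \<le> card X \<and> S \<subseteq> K \<rightarrow>\<^sub>E X \<and>
      d\<^sup>2 / 2 * real (card X) ^ card K \<le> card S \<longrightarrow>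
      (\<exists>\<phi> \<psi>. (\<forall>k\<in>K. \<phi> k \<in> X \<and> \<psi> k \<in> X \<and> \<phi> k \<noteq> \<psi> k) \<and>
          (\<forall>A. (\<lambda>k\<in>K. if k \<in> A then \<phi> k else \<psi> k) \<in> S))" ..
  obtain n2 :: nat where n2: "2 / d\<^sup>2 < n2" using reals_Archimedean2 by blast
  show ?case
  proof (intro exI[of _ "max n1 n2"] allI impI, elim conjE)
    fix X :: "'a set" and S assume X: "finite X" and n: "max n1 n2 \<le> card X" and S: "S \<subseteq> insert k K \<rightarrow>\<^sub>E X"
      and dense: "d * real (card X) ^ card (insert k K) \<le> card S"
    have "2 / d\<^sup>2 < card X" using n n2 by linarith
    then obtain x y where xy: "x \<in> X" "y \<in> X" "x \<noteq> y"
      "d\<^sup>2 / 2 * real (card X) ^ card K \<le> card {\<phi> \<in> K \<rightarrow>\<^sub>E X. \<phi>(k := x) \<in> S \<and> \<phi>(k := y) \<in> S}"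
      using dense_imp_common_link_dense[OF insert.hyps(1) X insert.hyps(2) S insert.prems] dense by blast
    let ?T = "{\<phi> \<in> K \<rightarrow>\<^sub>E X. \<phi>(k := x) \<in> S \<and> \<phi>(k := y) \<in> S}"
    obtain \<phi> \<psi> where IH: "\<forall>k\<in>K. \<phi> k \<in> X \<and> \<psi> k \<in> X \<and> \<phi> k \<noteq> \<psi> k"
      "\<And>A. (\<lambda>k\<in>K. if k \<in> A then \<phi> k else \<psi> k) \<in> ?T"
    proof -
      have "finite X \<and> n1 \<le> card X \<and> ?T \<subseteq> K \<rightarrow>\<^sub>E X \<and> d\<^sup>2 / 2 * real (card X) ^ card K \<le> card ?T"
        using X n xy(4) by auto
      from n1[rule_format, OF this] show ?thesis using that by blast
    qed
    have "(\<lambda>j\<in>insert k K. if j \<in> A then (\<phi>(k := x)) j else (\<psi>(k := y)) j) \<in> S" for A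
    proof -
      have "(\<lambda>j\<in>insert k K. if j \<in> A then (\<phi>(k := x)) j else (\<psi>(k := y)) j)
        = (\<lambda>j\<in>K. if j \<in> A then \<phi> j else \<psi> j)(k := if k \<in> A then x else y)"
        using insert.hyps(2) by (auto simp: fun_eq_iff restrict_def)
      then show ?thesis using IH(2)[of A] by auto
    qed
    then show "\<exists>\<phi> \<psi>. (\<forall>k\<in>insert k K. \<phi> k \<in> X \<and> \<psi> k \<in> X \<and> \<phi> k \<noteq> \<psi> k) \<and>
          (\<forall>A. (\<lambda>k\<in>insert k K. if k \<in> A then \<phi> k else \<psi> k) \<in> S)"
      using IH(1) xy insert.hyps(2) by (intro exI[of _ "\<phi>(k := x)"] exI[of _ "\<psi>(k := y)"]) auto
  qed
qed

section \<open>Codegrees, doubled edges and Fano planes\<close>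

text \<open>The neighbourhood of a pair as a set of vertices, where \<open>nbhd\<close> has
  singletons.\<close>

definition pair_nbhd :: "'a set set \<Rightarrow> 'a \<Rightarrow> 'a \<Rightarrow> 'a set" where
  "pair_nbhd E a b = {x. {a, b, x} \<in> E}"

lemma pair_nbhd_subset: "is_3graph X E \<Longrightarrow> pair_nbhd E a b \<subseteq> X"
  by (auto simp: pair_nbhd_def is_3graph_def)

lemma is_3graph_distinct:
  assumes "is_3graph X E" "{a, b, c} \<in> E"
  shows "a \<noteq> b" "a \<noteq> c" "b \<noteq> c"
  using assms by (auto simp: is_3graph_def insert_commute card_insert_if dest!: bspec split: if_splits)

text \<open>Edges have three elements, so every member of \<open>nbhd X E {a, b}\<close> is a
  singleton.\<close>

lemma min_codegree_le_card_pair_nbhd: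
  assumes "finite X" "is_3graph X E" "a \<in> X" "b \<in> X" "a \<noteq> b"
  shows "min_codegree X E \<le> card (pair_nbhd E a b)"
proof -
  let ?C = "{card (nbhd X E S) | S. S \<subseteq> X \<and> card S = 2}"
  have "?C \<subseteq> (\<lambda>S. card (nbhd X E S)) ` Pow X" by auto
  then have "finite ?C" using assms(1) by (meson finite_Pow_iff finite_imageI finite_subset)
  then have "min_codegree X E \<le> card (nbhd X E {a, b})"
    unfolding min_codegree_def using assms(3-5) by (intro Min_le) (auto intro!: exI[of _ "{a, b}"])
  also have "nbhd X E {a, b} \<subseteq> (\<lambda>x. {x}) ` pair_nbhd E a b"
  proof
    fix T assume T: "T \<in> nbhd X E {a, b}"
    then have "card ({a, b} \<union> T) = 3" "finite T" "{a, b} \<inter> T = {}"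
      using assms(1,2) by (auto simp: nbhd_def is_3graph_def intro: finite_subset)
    then have "card T = 1" using assms(5) by (simp add: card_Un_disjoint)
    then obtain x where "T = {x}" by (auto simp: card_1_singleton_iff)
    then show "T \<in> (\<lambda>x. {x}) ` pair_nbhd E a b"
      using T by (auto simp: nbhd_def pair_nbhd_def insert_commute)
  qed
  then have "card (nbhd X E {a, b}) \<le> card (pair_nbhd E a b)"
    using pair_nbhd_subset[OF assms(2)] assms(1) by (meson surj_card_le finite_subset)
  finally show ?thesis .
qed

text \<open>Deleting a point of the Fano plane splits the other six into three pairs, one for each
  line through it. The remaining four lines are transversals of these pairs, and here all eight
  transversals are edges.\<close>

lemma contains_fano_of_doubled_edge:
  assumes H: "is_3graph X E"
    and d: "x \<noteq> x'" "y \<noteq> y'" "z \<noteq> z'"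
    and e: "\<And>p q r. p \<in> {x, x'} \<Longrightarrow> q \<in> {y, y'} \<Longrightarrow> r \<in> {z, z'} \<Longrightarrow> {p, q, r} \<in> E"
    and v: "v \<in> pair_nbhd E x x'" "v \<in> pair_nbhd E y y'" "v \<in> pair_nbhd E z z'"
  shows "contains_fano X E"
proof -
  \<comment> \<open>The lines through \<open>(False, False, True)\<close>, the preimage of \<open>v\<close>, carry the three doubled pairs.\<close>
  define f :: "fano_pt \<Rightarrow> 'a" where
    "f = (\<lambda>(a, b, c). if a then (if b then (if c then z' else z) else (if c then x' else x))
                      else (if b then (if c then y' else y) else v))"
  have ve: "{x, x', v} \<in> E" "{y, y', v} \<in> E" "{z, z', v} \<in> E"
    using v by (auto simp: pair_nbhd_def)
  have sub: "\<And>e. e \<in> E \<Longrightarrow> e \<subseteq> X" using H by (auto simp: is_3graph_def)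
  \<comment> \<open>The first four triples are the lines avoiding the preimage of \<open>v\<close>:
    the last bits on a line sum to zero, so the number of primed vertices is even.\<close>
  have ee: "{x, y, z} \<in> E" "{x, y', z'} \<in> E" "{x', y, z'} \<in> E" "{x', y', z} \<in> E"
    "{x, y, z'} \<in> E" "{x, y', z} \<in> E" "{x', y, z} \<in> E" "{x', y', z'} \<in> E"
    using e by auto
  note ne = d ve[THEN is_3graph_distinct(1)[OF H]] ve[THEN is_3graph_distinct(2)[OF H]]
    ve[THEN is_3graph_distinct(3)[OF H]] ee[THEN is_3graph_distinct(1)[OF H]]
    ee[THEN is_3graph_distinct(2)[OF H]] ee[THEN is_3graph_distinct(3)[OF H]]
  have "inj_on f fano_vertices"
    using ne ne[symmetric]
    by (auto simp: inj_on_def fano_vertices_def f_def split: if_splits)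
  moreover have "f ` fano_vertices \<subseteq> X"
    using sub[OF ve(1)] sub[OF ve(2)] sub[OF ve(3)]
    by (auto simp: fano_vertices_def f_def split: if_splits)
  moreover have "f ` w \<in> E" if "w \<in> fano_edges" for w
  proof -
    from that obtain a b where w: "w = {a, b, f2_add a b}"
      and ab: "a \<in> fano_vertices" "b \<in> fano_vertices" "f2_add a b \<in> fano_vertices"
      unfolding fano_edges_def by blast
    obtain a1 a2 a3 where a: "a = (a1, a2, a3)" by (cases a)
    obtain b1 b2 b3 where b: "b = (b1, b2, b3)" by (cases b)
    \<comment> \<open>A line arises from every ordered pair of its points, so its edge may be needed
      in any of the six orders.\<close>
    have perm: "{q, p, r} \<in> E" "{p, r, q} \<in> E" "{q, r, p} \<in> E" "{r, p, q} \<in> E" "{r, q, p} \<in> E"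
      if "{p, q, r} \<in> E" for p q r using that by (simp_all add: insert_commute)
    note lines = ve ee(1-4)
    note lines' = lines lines[THEN perm(1)] lines[THEN perm(2)] lines[THEN perm(3)]
      lines[THEN perm(4)] lines[THEN perm(5)]
    have "{f (a1, a2, a3), f (b1, b2, b3), f (a1 \<noteq> b1, a2 \<noteq> b2, a3 \<noteq> b3)} \<in> E"
      using ab unfolding a b
      by (cases a1; cases a2; cases a3; cases b1; cases b2; cases b3)
        (simp_all add: f_def fano_vertices_def lines')
    then show ?thesis by (simp add: w a b)
  qed
  ultimately show ?thesis by (auto simp: contains_fano_def)
qed

text \<open>Double counting the incidences between vertices and neighbourhoods of pairs gives a
  vertex \<open>v\<close> joined to at least the average number of pairs. If all choices of
  representatives from three of these pairs were edges, \<open>v\<close> would complete a Fano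
  plane.\<close>

lemma doubled_tuple_independent_set:
  assumes X: "finite X" and H: "is_3graph X E" and nofano: "\<not> contains_fano X E"
    and K: "finite K" and \<phi>: "\<And>k. k \<in> K \<Longrightarrow> \<phi> k \<in> X \<and> \<psi> k \<in> X \<and> \<phi> k \<noteq> \<psi> k"
  obtains I where "I \<subseteq> K" "min_codegree X E * card K \<le> card I * card X"
    "\<And>i j k. i \<in> I \<Longrightarrow> j \<in> I \<Longrightarrow> k \<in> I \<Longrightarrow> \<exists>A. {if i \<in> A then \<phi> i else \<psi> i,
        if j \<in> A then \<phi> j else \<psi> j, if k \<in> A then \<phi> k else \<psi> k} \<notin> E"
proof (cases "X = {}")
  case True
  then have "K = {}" using \<phi> by auto
  then show ?thesis using that[of "{}"] by auto
next
  case False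
  define N where "N k = pair_nbhd E (\<phi> k) (\<psi> k)" for k
  define I where "I v = {k \<in> K. v \<in> N k}" for v
  define D where "D = min_codegree X E"
  have n: "0 < card X" using False X by (simp add: card_gt_0_iff)
  have NX: "N k \<subseteq> X" for k using pair_nbhd_subset[OF H] by (simp add: N_def)
  have "\<exists>v\<in>X. D * card K \<le> card (I v) * card X"
  proof (rule ccontr)
    assume "\<not> ?thesis"
    then have "(\<Sum>v\<in>X. card (I v) * card X) < (\<Sum>v\<in>X. D * card K)"
      using X False by (intro sum_strict_mono) auto
    then have "(\<Sum>v\<in>X. card (I v)) < D * card K"
      using n by (simp add: mult.commute[of _ "card X"] flip: sum_distrib_left)
    also have "D * card K = (\<Sum>k\<in>K. D)" by simp
    also have "\<dots> \<le> (\<Sum>k\<in>K. card (N k))"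
      unfolding N_def D_def using X H \<phi> by (intro sum_mono min_codegree_le_card_pair_nbhd) auto
    also have "\<dots> = (\<Sum>v\<in>X. card (I v))"
    proof -
      have "card (N k) = (\<Sum>v\<in>X. if v \<in> N k then 1 else 0)" for k
        using NX[of k] X by (simp add: sum.If_cases Int_absorb1)
      moreover have "card (I v) = (\<Sum>k\<in>K. if v \<in> N k then 1 else 0)" for v
        using K by (simp add: sum.If_cases I_def Int_def)
      ultimately show ?thesis using sum.swap[of "\<lambda>k v. if v \<in> N k then 1 else 0 :: nat" X K] by simp
    qed
    finally show False by simp
  qed
  then obtain v where v: "v \<in> X" "D * card K \<le> card (I v) * card X" by blast
  show ?thesis
  proof (rule that)
    show "I v \<subseteq> K" by (auto simp: I_def)
    show "min_codegree X E * card K \<le> card (I v) * card X" using v by (simp add: D_def)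
    fix i j k assume ijk: "i \<in> I v" "j \<in> I v" "k \<in> I v"
    let ?\<chi> = "\<lambda>A k. if k \<in> A then \<phi> k else \<psi> k"
    show "\<exists>A. {?\<chi> A i, ?\<chi> A j, ?\<chi> A k} \<notin> E"
    proof (rule ccontr)
      assume "\<not> ?thesis"
      then have all: "\<And>A. {?\<chi> A i, ?\<chi> A j, ?\<chi> A k} \<in> E" by blast
      \<comment> \<open>Equal indices would repeat a representative, leaving fewer than three
        vertices in an edge.\<close>
      have ne: "i \<noteq> j" "i \<noteq> k" "j \<noteq> k" using is_3graph_distinct[OF H all[of UNIV]] by auto
      have "{p, q, r} \<in> E" if "p \<in> {\<phi> i, \<psi> i}" "q \<in> {\<phi> j, \<psi> j}" "r \<in> {\<phi> k, \<psi> k}" for p q r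
        \<comment> \<open>This \<open>A\<close> encodes the choice of \<open>p\<close>,
          \<open>q\<close>, \<open>r\<close>; as the indices differ, the three choices do not
          interfere.\<close>
        using all[of "(if p = \<phi> i then {i} else {}) \<union> (if q = \<phi> j then {j} else {}) \<union>
          (if r = \<phi> k then {k} else {})"] that ne by (auto split: if_splits)
      then have "contains_fano X E"
        using ijk \<phi> by (intro contains_fano_of_doubled_edge[OF H, of "\<phi> i" "\<psi> i" "\<phi> j" "\<psi> j" "\<phi> k" "\<psi> k" v])
          (auto simp: I_def N_def)
      then show False using nofano by simp
    qed
  qed
qed

section \<open>Block weights and their mean\<close>

text \<open>If an independent set contains a pair with neighbourhood \<open>N\<close>, it avoids \<open>N\<close> and misses a vertex of
  every edge outside \<open>N\<close>, so it contains at most \<open>3 * block_weight E N (x, y, z)\<close> entries of a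
  block \<open>(x, y, z)\<close>.\<close>

definition block_weight :: "'a set set \<Rightarrow> 'a set \<Rightarrow> 'a \<times> 'a \<times> 'a \<Rightarrow> real" where
  "block_weight E N = (\<lambda>(x, y, z). (of_bool (x \<notin> N) + of_bool (y \<notin> N) + of_bool (z \<notin> N)
     - of_bool (x \<notin> N \<and> y \<notin> N \<and> z \<notin> N \<and> {x, y, z} \<in> E)) / 3)"

lemma block_weight_bounds: "0 \<le> block_weight E N p \<and> block_weight E N p \<le> 1"
  by (cases p) (auto simp: block_weight_def of_bool_def)

text \<open>One ordering of each edge is enough for this bound.\<close>

lemma spanned_edges_le_card_triples:
  assumes "finite Z" "is_3graph X E"
  shows "spanned_edges E Z \<le> card {(x, y, z). x \<in> Z \<and> y \<in> Z \<and> z \<in> Z \<and> {x, y, z} \<in> E}"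
    (is "_ \<le> card ?T")
proof -
  have "?T \<subseteq> Z \<times> Z \<times> Z" by auto
  then have "finite ?T" using assms(1) by (meson finite_SigmaI finite_subset)
  moreover have "{e \<in> E. e \<subseteq> Z} \<subseteq> (\<lambda>(x, y, z). {x, y, z}) ` ?T"
  proof
    fix e assume e: "e \<in> {e \<in> E. e \<subseteq> Z}"
    then have "card e = 3" using assms(2) by (auto simp: is_3graph_def)
    then obtain x y z where "e = {x, y, z}" by (auto simp: card_3_iff)
    then show "e \<in> (\<lambda>(x, y, z). {x, y, z}) ` ?T" using e by (intro image_eqI[of _ _ "(x, y, z)"]) auto
  qed
  ultimately show ?thesis unfolding spanned_edges_def by (rule surj_card_le)
qed

text \<open>Each coordinate lies outside \<open>N\<close> in
  \<open>card (X - N) * (card X)\<^sup>2\<close> of the triples. The correction term counts ordered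
  triples in \<open>X - N\<close> that form an edge.\<close>

lemma sum_block_weight_le:
  assumes X: "finite X" and H: "is_3graph X E"
  shows "(\<Sum>p\<in>X \<times> X \<times> X. block_weight E N p)
         \<le> real (card (X - N)) * (real (card X))\<^sup>2 - real (spanned_edges E (X - N)) / 3"
proof -
  define Z where "Z = X - N"
  define T where "T = {(x, y, z). x \<in> Z \<and> y \<in> Z \<and> z \<in> Z \<and> {x, y, z} \<in> E}"
  have Z: "(\<Sum>x\<in>X. of_bool (x \<notin> N) :: real) = card Z"
    using X by (simp add: of_bool_def sum.If_cases Z_def Diff_eq Compl_eq)
  have "T = {p \<in> X \<times> X \<times> X. case p of (x, y, z) \<Rightarrow> x \<notin> N \<and> y \<notin> N \<and> z \<notin> N \<and> {x, y, z} \<in> E}"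
    by (auto simp: T_def Z_def)
  then have T: "(\<Sum>p\<in>X \<times> X \<times> X. of_bool (case p of (x, y, z) \<Rightarrow> x \<notin> N \<and> y \<notin> N \<and> z \<notin> N \<and> {x, y, z} \<in> E) :: real)
      = card T"
    using X by (simp add: of_bool_def sum.If_cases Int_def)
  have "(\<Sum>p\<in>X \<times> X \<times> X. block_weight E N p)
      = ((\<Sum>(x, y, z)\<in>X \<times> X \<times> X. of_bool (x \<notin> N) :: real) + (\<Sum>(x, y, z)\<in>X \<times> X \<times> X. of_bool (y \<notin> N) :: real)
         + (\<Sum>(x, y, z)\<in>X \<times> X \<times> X. of_bool (z \<notin> N) :: real) - card T) / 3"
    unfolding block_weight_def T[symmetric]
    by (simp add: case_prod_unfold sum.distrib sum_subtractf flip: sum_divide_distrib)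
  also have "\<dots> = (3 * (card Z * (real (card X))\<^sup>2) - card T) / 3"
    using X by (simp add: Z mult.assoc flip: sum.cartesian_product sum_distrib_left sum_distrib_right)
      (simp add: power2_eq_square)
  also have "\<dots> \<le> card Z * (real (card X))\<^sup>2 - real (spanned_edges E Z) / 3"
    using spanned_edges_le_card_triples[of Z X E] X H by (simp add: T_def Z_def)
  finally show ?thesis by (simp add: Z_def)
qed

text \<open>The constant is \<open>1152 = 3 * 6 * 4 ^ 3\<close>, where \<open>4\<close> comes from \<open>card (X - N) \<ge> card X / 4\<close>.\<close>

lemma mean_block_weight_le:
  fixes \<epsilon> \<theta> :: real
  assumes X: "finite X" and H: "is_3graph X E" and \<epsilon>: "0 < \<epsilon>" "\<epsilon> \<le> 1/4" and \<theta>: "0 < \<theta>"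
    and dense: "\<And>Z. Z \<subseteq> X \<Longrightarrow> real (card Z) > (1/2 - \<epsilon>) * card X \<Longrightarrow>
        real (spanned_edges E Z) > \<epsilon> * real (card Z) ^ 3 / 6"
    and N: "N \<subseteq> X" "real (card N) > (1/2 - \<theta>) * card X"
  shows "(\<Sum>p\<in>X \<times> X \<times> X. block_weight E N p) \<le> (1/2 + \<theta> - \<epsilon>/1152) * card (X \<times> X \<times> X)"
proof -
  define n where "n = real (card X)"
  define z where "z = real (card (X - N))"
  have n: "0 \<le> n" by (simp add: n_def)
  have z: "z = n - card N"
    using N X by (simp add: z_def n_def card_Diff_subset finite_subset of_nat_diff card_mono)
  have "z * n\<^sup>2 - real (spanned_edges E (X - N)) / 3 \<le> (1/2 + \<theta> - \<epsilon>/1152) * n ^ 3"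
  \<comment> \<open>Either \<open>N\<close> exceeds half of \<open>X\<close> by at least
    \<open>\<epsilon> * n\<close> and the main term alone is small enough, or the complement of
    \<open>N\<close> is large enough for \<open>dense\<close>, and the correction term provides the
    gain.\<close>
  proof (cases "z > (1/2 - \<epsilon>) * n")
    case False
    then have "z * n\<^sup>2 \<le> (1/2 - \<epsilon>) * n * n\<^sup>2" by (intro mult_right_mono) auto
    also have "\<dots> = (1/2 - \<epsilon>) * n ^ 3" by (simp add: power2_eq_square power3_eq_cube)
    also have "\<dots> \<le> (1/2 + \<theta> - \<epsilon>/1152) * n ^ 3" using \<epsilon> \<theta> n by (intro mult_right_mono) auto
    finally show ?thesis by linarith
  next
    case True
    then have "real (spanned_edges E (X - N)) > \<epsilon> * z ^ 3 / 6"
      using dense[of "X - N"] by (auto simp: z_def n_def)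
    moreover have "(1/4) * n \<le> (1/2 - \<epsilon>) * n" using \<epsilon> n by (intro mult_right_mono) auto
    then have "((1/4) * n) ^ 3 \<le> z ^ 3" using True n by (intro power_mono) auto
    then have "\<epsilon> * (n ^ 3 / 64) \<le> \<epsilon> * z ^ 3" using \<epsilon> by (simp add: power_mult_distrib power_divide)
    \<comment> \<open>The codegree bound enters here, as an upper bound on the complement of
      \<open>N\<close>.\<close>
    moreover have "z * n\<^sup>2 \<le> ((1/2 + \<theta>) * n) * n\<^sup>2"
      using N(2) z by (intro mult_right_mono) (auto simp: n_def algebra_simps)
    then have "z * n\<^sup>2 \<le> (1/2 + \<theta>) * n ^ 3" by (simp add: power2_eq_square power3_eq_cube mult.assoc)
    ultimately show ?thesis by (simp add: algebra_simps)
  qed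
  then show ?thesis
    using sum_block_weight_le[OF X H, of N]
    by (simp add: z_def n_def card_cartesian_product power3_eq_cube)
qed

section \<open>Typical samples of blocks\<close>

definition coord :: "nat \<Rightarrow> 'a \<times> 'a \<times> 'a \<Rightarrow> 'a" where
  "coord c = (\<lambda>(x, y, z). if c = 0 then x else if c = 1 then y else z)"

text \<open>The pair is taken from two different blocks, which are left out of the sum because the
  neighbourhood depends on them; \<open>m - 2\<close> independent blocks remain. Distinctness makes
  the codegree bound available for the pair.\<close>

definition typical_sample :: "'a set set \<Rightarrow> real \<Rightarrow> nat \<Rightarrow> (nat \<Rightarrow> 'a \<times> 'a \<times> 'a) \<Rightarrow> bool" where
  "typical_sample E \<nu> m \<Phi> \<longleftrightarrow> (\<forall>t<m. \<forall>t'<m. \<forall>c<3. \<forall>c'<3. t \<noteq> t' \<longrightarrow>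
     coord c (\<Phi> t) \<noteq> coord c' (\<Phi> t') \<and>
     (\<Sum>s\<in>{..<m} - {t, t'}. block_weight E (pair_nbhd E (coord c (\<Phi> t)) (coord c' (\<Phi> t'))) (\<Phi> s))
       < \<nu> * real (m - 2))"

text \<open>More than three indices cannot lie in one block, so \<open>I\<close> supplies a pair
  \<open>a\<close>, \<open>b\<close> from two blocks and avoids its neighbourhood. The two blocks
  contribute at most \<open>6\<close>; the others are bounded by their weights.\<close>

lemma typical_sample_independent_card_le:
  assumes typical: "typical_sample E \<nu> m \<Phi>"
    and I: "I \<subseteq> {..<m} \<times> {..<3}" "3 < card I"
    and indep: "\<And>s c s' c' s'' c''. (s, c) \<in> I \<Longrightarrow> (s', c') \<in> I \<Longrightarrow> (s'', c'') \<in> I \<Longrightarrow>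
       {coord c (\<Phi> s), coord c' (\<Phi> s'), coord c'' (\<Phi> s'')} \<notin> E"
  shows "card I \<le> 6 + 3 * (\<nu> * real (m - 2))"
proof -
  define J where "J s = {c \<in> {..<3}. (s, c) \<in> I}" for s
  have J3: "card (J s) \<le> 3" for s
    using card_mono[of "{..<3::nat}" "J s"] by (auto simp: J_def)
  have "I = (SIGMA s:{..<m}. J s)" using I(1) by (auto simp: J_def)
  then have "card I = card (SIGMA s:{..<m}. J s)" by simp
  also have "\<dots> = (\<Sum>s<m. card (J s))" by (rule card_SigmaI) (auto simp: J_def)
  finally have cardI: "card I = (\<Sum>s<m. card (J s))" .
  have "I \<noteq> {}" using I(2) by auto
  then obtain t c where tc: "(t, c) \<in> I" by auto
  have "\<not> I \<subseteq> {t} \<times> {..<3}"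
  proof
    assume "I \<subseteq> {t} \<times> {..<3}"
    then have "card I \<le> card ({t} \<times> {..<3::nat})" by (intro card_mono) auto
    then show False using I(2) by (simp add: card_cartesian_product)
  qed
  then obtain t' c' where tc': "(t', c') \<in> I" "t \<noteq> t'" using I(1) by auto
  have lt: "t < m" "t' < m" "c < 3" "c' < 3" using tc tc' I(1) by auto
  define a b where "a = coord c (\<Phi> t)" and "b = coord c' (\<Phi> t')"
  define N where "N = pair_nbhd E a b"
  have block: "real (card (J s)) \<le> 3 * block_weight E N (\<Phi> s)" for s
  proof -
    have notN: "coord d (\<Phi> s) \<notin> N" if "d \<in> J s" for d
      using indep[OF tc tc'(1), of s d] that by (auto simp: J_def N_def pair_nbhd_def a_def b_def)
    obtain x y z where xyz: "\<Phi> s = (x, y, z)" by (cases "\<Phi> s")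
    have x: "x \<notin> N" if "0 \<in> J s" using notN[OF that] by (simp add: xyz coord_def)
    have y: "y \<notin> N" if "1 \<in> J s" using notN[OF that] by (simp add: xyz coord_def)
    have z: "z \<notin> N" if "2 \<in> J s" using notN[OF that] by (simp add: xyz coord_def)
    have edge: "{x, y, z} \<notin> E" if "0 \<in> J s" "1 \<in> J s" "2 \<in> J s"
      using indep[of s 0 s 1 s 2] that by (simp add: J_def xyz coord_def)
    have "J s = {c \<in> {..<3}. c \<in> J s}" by (auto simp: J_def)
    then have "real (card (J s)) = (\<Sum>c<3. of_bool (c \<in> J s))"
      by (simp add: of_bool_def sum.If_cases Int_def)
    also have "\<dots> = of_bool (0 \<in> J s) + of_bool (1 \<in> J s) + of_bool (2 \<in> J s)"
      by (simp add: numeral_3_eq_3 numeral_2_eq_2)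
    \<comment> \<open>If all three indices are present, the block is no edge and nothing is
      subtracted. If the correction applies, at most two are present, while the three vertices
      outside \<open>N\<close> still leave the value \<open>2\<close>.\<close>
    also have "\<dots> \<le> 3 * block_weight E N (x, y, z)"
      using x y z edge by (cases "0 \<in> J s"; cases "1 \<in> J s"; cases "2 \<in> J s")
        (simp_all add: block_weight_def of_bool_def)
    finally show ?thesis by (simp only: xyz)
  qed
  have "real (card I) = (\<Sum>s\<in>{..<m} - {t, t'}. real (card (J s))) + (\<Sum>s\<in>{t, t'}. real (card (J s)))"
    using lt by (simp add: cardI sum.subset_diff[of "{t, t'}" "{..<m}"])
  also have "\<dots> \<le> (\<Sum>s\<in>{..<m} - {t, t'}. 3 * block_weight E N (\<Phi> s)) + 6"
    using J3[of t] J3[of t'] tc'(2) by (intro add_mono sum_mono block) auto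
  also have "\<dots> = 3 * (\<Sum>s\<in>{..<m} - {t, t'}. block_weight E N (\<Phi> s)) + 6"
    by (simp add: sum_distrib_left)
  also have "\<dots> \<le> 3 * (\<nu> * real (m - 2)) + 6"
    using typical lt tc'(2) unfolding typical_sample_def N_def a_def b_def by fastforce
  finally show ?thesis by simp
qed

text \<open>When all blocks but \<open>t\<close> are fixed, one coordinate of block \<open>t\<close>
  is forced, leaving a fraction \<open>1 / card X\<close> of its values.\<close>

lemma card_coincidence_le:
  assumes X: "finite X" "X \<noteq> {}" and t: "t < m" "t' < m" "t \<noteq> t'"
  shows "real (card {\<Phi> \<in> {..<m} \<rightarrow>\<^sub>E X \<times> X \<times> X. coord c (\<Phi> t) = coord c' (\<Phi> t')})
         \<le> 1 / card X * real (card (X \<times> X \<times> X)) ^ m"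
proof -
  let ?Y = "X \<times> X \<times> X" and ?K = "{..<m} - {t}"
  let ?S = "{\<Phi> \<in> {..<m} \<rightarrow>\<^sub>E ?Y. coord c (\<Phi> t) = coord c' (\<Phi> t')}"
  have Y: "finite ?Y" using X by simp
  have m: "insert t ?K = {..<m}" using t by auto
  have n: "0 < card X" using X by (simp add: card_gt_0_iff)
  have "card ?S = (\<Sum>\<phi>\<in>?K \<rightarrow>\<^sub>E ?Y. card {y \<in> ?Y. \<phi>(t := y) \<in> ?S})"
    by (rule card_PiE_insert_eq_sum) (use Y m in auto)
  also have "\<dots> \<le> (\<Sum>\<phi>\<in>?K \<rightarrow>\<^sub>E ?Y. card X * card X)"
  proof (rule sum_mono)
    fix \<phi> assume "\<phi> \<in> ?K \<rightarrow>\<^sub>E ?Y"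
    define a where "a = coord c' (\<phi> t')"
    define h where "h = (\<lambda>(u, v). if c = 0 then (a, u, v) else if c = 1 then (u, a, v) else (u, v, a))"
    have "{y \<in> ?Y. \<phi>(t := y) \<in> ?S} \<subseteq> h ` (X \<times> X)"
    proof
      fix y assume y: "y \<in> {y \<in> ?Y. \<phi>(t := y) \<in> ?S}"
      then obtain u v w where uvw: "y = (u, v, w)" "u \<in> X" "v \<in> X" "w \<in> X" by auto
      have "coord c y = a" using y t by (auto simp: a_def)
      then show "y \<in> h ` (X \<times> X)"
        using uvw by (force simp: h_def coord_def split: if_splits)
    qed
    then have "card {y \<in> ?Y. \<phi>(t := y) \<in> ?S} \<le> card (X \<times> X)"
      using X by (intro surj_card_le) auto
    then show "card {y \<in> ?Y. \<phi>(t := y) \<in> ?S} \<le> card X * card X"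
      by (simp add: card_cartesian_product)
  qed
  also have "\<dots> = card ?Y ^ (m - 1) * (card X * card X)"
    using t by (simp add: card_funcsetE)
  finally have "real (card ?S) \<le> real (card ?Y ^ (m - 1) * (card X * card X))"
    by (simp only: of_nat_le_iff)
  also have "\<dots> = 1 / card X * real (card ?Y) ^ m"
    using n t by (cases m) (auto simp: card_cartesian_product)
  finally show ?thesis .
qed

text \<open>Union bound over the \<open>9 * m\<^sup>2\<close> choices of two positions. A failure is
  either a coincidence (\<open>C\<close>) or a large weight sum for distinct vertices
  (\<open>W\<close>), handled by the seeded Chernoff bound.\<close>

lemma card_not_typical_sample_le:
  fixes \<mu> \<delta> :: real
  assumes X: "finite X" "X \<noteq> {}" and \<delta>: "0 \<le> \<delta>" "\<delta> \<le> 1"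
    and mean: "\<And>a b. a \<in> X \<Longrightarrow> b \<in> X \<Longrightarrow> a \<noteq> b \<Longrightarrow>
      (\<Sum>p\<in>X \<times> X \<times> X. block_weight E (pair_nbhd E a b) p) \<le> \<mu> * card (X \<times> X \<times> X)"
  shows "real (card {\<Phi> \<in> {..<m} \<rightarrow>\<^sub>E X \<times> X \<times> X. \<not> typical_sample E (\<mu> + \<delta>) m \<Phi>})
     \<le> 9 * (real m)\<^sup>2 * (exp (- (\<delta>\<^sup>2 / 4) * real (m - 2)) + 1 / card X) * real (card (X \<times> X \<times> X)) ^ m"
proof -
  let ?Y = "X \<times> X \<times> X"
  let ?P = "{..<m} \<times> {..<m} \<times> {..<3::nat} \<times> {..<3::nat}"
  define C where "C = (\<lambda>(t, t', c, c'). {\<Phi> \<in> {..<m} \<rightarrow>\<^sub>E ?Y. t \<noteq> t' \<and> coord c (\<Phi> t) = coord c' (\<Phi> t')})"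
  define W where "W = (\<lambda>(t, t', c, c'). {\<Phi> \<in> {..<m} \<rightarrow>\<^sub>E ?Y. t \<noteq> t' \<and>
      coord c (\<Phi> t) \<noteq> coord c' (\<Phi> t') \<and> (\<mu> + \<delta>) * real (m - 2) \<le>
     (\<Sum>s\<in>{..<m} - {t, t'}. block_weight E (pair_nbhd E (coord c (\<Phi> t)) (coord c' (\<Phi> t'))) (\<Phi> s))})"
  define q where "q = exp (- (\<delta>\<^sup>2 / 4) * real (m - 2))"
  let ?B = "{\<Phi> \<in> {..<m} \<rightarrow>\<^sub>E ?Y. \<not> typical_sample E (\<mu> + \<delta>) m \<Phi>}"
  have Y: "finite ?Y" using X by simp
  have fin: "finite ({..<m} \<rightarrow>\<^sub>E ?Y)" using Y by (intro finite_PiE) auto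
  have coordX: "coord c y \<in> X" if "y \<in> ?Y" for c y using that by (auto simp: coord_def)
  have "?B \<subseteq> (\<Union>p\<in>?P. W p \<union> C p)"
  proof
    fix \<Phi> assume B: "\<Phi> \<in> ?B"
    then obtain t t' c c' where *: "t < m" "t' < m" "c < 3" "c' < 3" "t \<noteq> t'"
      "\<not> (coord c (\<Phi> t) \<noteq> coord c' (\<Phi> t') \<and>
     (\<Sum>s\<in>{..<m} - {t, t'}. block_weight E (pair_nbhd E (coord c (\<Phi> t)) (coord c' (\<Phi> t'))) (\<Phi> s))
       < (\<mu> + \<delta>) * real (m - 2))"
      unfolding typical_sample_def by blast
    then have "\<Phi> \<in> W (t, t', c, c') \<union> C (t, t', c, c')"
      using B unfolding W_def C_def by (auto simp: not_less)
    moreover have "(t, t', c, c') \<in> ?P" using * by simp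
    ultimately show "\<Phi> \<in> (\<Union>p\<in>?P. W p \<union> C p)" by blast
  qed
  moreover have "finite (\<Union>p\<in>?P. W p \<union> C p)"
    using fin by (intro finite_UN_I) (auto simp: W_def C_def)
  ultimately have "card ?B \<le> card (\<Union>p\<in>?P. W p \<union> C p)" by (intro card_mono)
  also have "\<dots> \<le> (\<Sum>p\<in>?P. card (W p \<union> C p))" by (rule card_UN_le) simp
  also have "\<dots> \<le> (\<Sum>p\<in>?P. card (W p) + card (C p))" by (intro sum_mono card_Un_le)
  finally have "real (card ?B) \<le> (\<Sum>p\<in>?P. real (card (W p)) + real (card (C p)))"
    by (simp flip: of_nat_add of_nat_sum)
  also have "\<dots> \<le> (\<Sum>p\<in>?P. q * real (card ?Y) ^ m + 1 / card X * real (card ?Y) ^ m)"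
  proof (intro sum_mono add_mono)
    fix p assume "p \<in> ?P"
    then obtain t t' c c' where p: "p = (t, t', c, c')" "t < m" "t' < m" by auto
    show "real (card (W p)) \<le> q * real (card ?Y) ^ m"
    proof (cases "t = t'")
      case False
      then have "W p = {\<Phi> \<in> {..<m} \<rightarrow>\<^sub>E ?Y. coord c (\<Phi> t) \<noteq> coord c' (\<Phi> t') \<and>
            (\<mu> + \<delta>) * real (card {..<m} - 2) \<le> (\<Sum>s\<in>{..<m} - {t, t'}.
              block_weight E (pair_nbhd E (coord c (\<Phi> t)) (coord c' (\<Phi> t'))) (\<Phi> s))}"
        by (simp add: W_def p)
      also have "real (card \<dots>) \<le> exp (- (\<delta>\<^sup>2 / 4) * real (card {..<m} - 2)) * real (card ?Y) ^ card {..<m}"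
      proof (rule chernoff_count_seeded
            [where F = "\<lambda>y y'. block_weight E (pair_nbhd E (coord c y) (coord c' y'))"
              and R = "\<lambda>y y'. coord c y \<noteq> coord c' y'"])
        show "t \<in> {..<m}" "t' \<in> {..<m}" using p by auto
      qed (rule finite_lessThan Y False \<delta> block_weight_bounds mean coordX | assumption)+
      finally show ?thesis by (simp add: q_def)
    qed (simp add: W_def p q_def)
    show "real (card (C p)) \<le> 1 / card X * real (card ?Y) ^ m"
      using card_coincidence_le[OF X p(2,3), of c c'] by (cases "t = t'") (auto simp: C_def p)
  qed
  also have "\<dots> = 9 * (real m)\<^sup>2 * (q + 1 / card X) * real (card ?Y) ^ m"
    by (simp add: card_cartesian_product power2_eq_square algebra_simps)
  finally show ?thesis by (simp only: q_def)
qed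

section \<open>Sample size and doubling of a typical sample\<close>

lemma sample_size_exists:
  fixes c r :: real
  assumes "0 < c"
  obtains m :: nat where "r \<le> m" "10 \<le> m" "9 * (real m)\<^sup>2 * exp (- c * real (m - 2)) \<le> 1/4"
proof -
  \<comment> \<open>The bound \<open>10\<close> gives \<open>m - 2 \<ge> m / 2\<close>, so that
    \<open>exp x \<ge> (x / 3) ^ 3 \<ge> (c * m / 6) ^ 3\<close>; the constant
    \<open>7776 = 36 * 6 ^ 3\<close> makes this at least \<open>36 * m\<^sup>2\<close>.\<close>
  obtain m :: nat where m: "max r (max 10 (7776 / c ^ 3)) \<le> m" using real_arch_simple by blast
  then have m10: "10 \<le> m" "7776 / c ^ 3 \<le> m" by auto
  define x where "x = c * real (m - 2)"
  have "c * real m / 6 \<le> x / 3" using m10(1) assms by (simp add: x_def of_nat_diff field_simps)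
  also have "\<dots> \<le> exp (x / 3)" using exp_ge_add_one_self[of "x / 3"] by linarith
  finally have "(c * real m / 6) ^ 3 \<le> exp (x / 3) ^ 3" using assms by (intro power_mono) auto
  also have "\<dots> = exp x" by (simp flip: exp_of_nat_mult)
  finally have e: "(c * real m / 6) ^ 3 \<le> exp x" .
  have "7776 \<le> c ^ 3 * m" using m10(2) assms by (simp add: field_simps)
  then have "7776 * (real m)\<^sup>2 \<le> c ^ 3 * m * (real m)\<^sup>2" by (intro mult_right_mono) auto
  then have "36 * (real m)\<^sup>2 \<le> (c * real m / 6) ^ 3"
    by (simp add: power_divide power_mult_distrib power3_eq_cube power2_eq_square mult_ac)
  then have "36 * (real m)\<^sup>2 \<le> exp x" using e by linarith
  then have "9 * (real m)\<^sup>2 * exp (- x) \<le> 1/4" by (simp add: exp_minus field_simps)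
  then show ?thesis using that[of m] m m10 by (simp add: x_def)
qed

lemma pigeonhole_real:
  fixes g :: "'b \<Rightarrow> 'c"
  assumes "finite B" "finite P" "P \<noteq> {}" "g ` B \<subseteq> P"
  obtains G where "G \<in> P" "real (card B) / card P \<le> card {x \<in> B. g x = G}"
proof -
  have "\<exists>G\<in>P. real (card B) / card P \<le> card {x \<in> B. g x = G}"
  proof (rule ccontr)
    assume "\<not> ?thesis"
    then have "(\<Sum>G\<in>P. real (card {x \<in> B. g x = G})) < (\<Sum>G\<in>P. real (card B) / card P)"
      using assms by (intro sum_strict_mono) auto
    also have "\<dots> = card B" using assms by simp
    also have "card B = (\<Sum>G\<in>P. card {x \<in> B. g x = G})"
      using sum.group[OF assms(1,2,4), of "\<lambda>_. 1 :: nat"] by simp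
    finally show False by simp
  qed
  then show ?thesis using that by blast
qed

text \<open>Concentration is a statement about \<open>m\<close> independent blocks, doubling one
  about \<open>3 * m\<close> single vertices; this map passes from the first view to the
  second.\<close>

definition flatten :: "nat \<Rightarrow> (nat \<Rightarrow> 'a \<times> 'a \<times> 'a) \<Rightarrow> nat \<times> nat \<Rightarrow> 'a" where
  "flatten m \<Phi> = (\<lambda>(s, c)\<in>{..<m} \<times> {..<3}. coord c (\<Phi> s))"

lemma flatten_in_PiE:
  "\<Phi> \<in> {..<m} \<rightarrow>\<^sub>E X \<times> X \<times> X \<Longrightarrow> flatten m \<Phi> \<in> {..<m} \<times> {..<3} \<rightarrow>\<^sub>E X"
  unfolding flatten_def by (rule restrict_PiE_iff[THEN iffD2]) (auto simp: coord_def dest!: PiE_mem)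

lemma inj_on_flatten: "inj_on (flatten m) ({..<m} \<rightarrow>\<^sub>E Y)"
proof (rule inj_onI)
  fix \<Phi> \<Psi> assume *: "\<Phi> \<in> {..<m} \<rightarrow>\<^sub>E Y" "\<Psi> \<in> {..<m} \<rightarrow>\<^sub>E Y" "flatten m \<Phi> = flatten m \<Psi>"
  have "\<Phi> s = \<Psi> s" if "s < m" for s
    using fun_cong[OF *(3), of "(s, 0)"] fun_cong[OF *(3), of "(s, 1)"] fun_cong[OF *(3), of "(s, 2)"] that
    by (cases "\<Phi> s"; cases "\<Psi> s") (auto simp: flatten_def coord_def)
  then show "\<Phi> = \<Psi>" using *(1,2) by (intro PiE_ext[of \<Phi> "{..<m}" "\<lambda>_. Y" \<Psi>]) auto
qed

text \<open>By pigeonhole, a positive fraction of the typical samples induce the same edge pattern, and this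
  family is dense enough to contain a doubled tuple.\<close>

lemma doubled_typical_sample:
  fixes m :: nat
  shows "\<exists>n0. \<forall>(X :: 'a set) E \<nu>. finite X \<and> n0 \<le> card X \<and>
     real (card (X \<times> X \<times> X)) ^ m / 2 \<le> card {\<Phi> \<in> {..<m} \<rightarrow>\<^sub>E X \<times> X \<times> X. typical_sample E \<nu> m \<Phi>} \<longrightarrow>
     (\<exists>\<Phi> \<phi> \<psi>. typical_sample E \<nu> m \<Phi> \<and>
       (\<forall>k\<in>{..<m} \<times> {..<3}. \<phi> k \<in> X \<and> \<psi> k \<in> X \<and> \<phi> k \<noteq> \<psi> k) \<and>
       (\<forall>i\<in>{..<m} \<times> {..<3}. \<forall>j\<in>{..<m} \<times> {..<3}. \<forall>k\<in>{..<m} \<times> {..<3}.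
          {flatten m \<Phi> i, flatten m \<Phi> j, flatten m \<Phi> k} \<in> E \<longrightarrow>
          (\<forall>A. {if i \<in> A then \<phi> i else \<psi> i, if j \<in> A then \<phi> j else \<psi> j,
                if k \<in> A then \<phi> k else \<psi> k} \<in> E)))"
proof -
  define K where "K = {..<m} \<times> {..<3::nat}"
  define P where "P = Pow (K \<times> K \<times> K)"
  have K: "finite K" "card K = 3 * m" by (auto simp: K_def card_cartesian_product)
  have P: "finite P" "P \<noteq> {}" using K by (auto simp: P_def)
  then have P0: "0 < card P" by (simp add: card_gt_0_iff)
  \<comment> \<open>The factor \<open>2\<close> accounts for the share of typical samples,
    \<open>card P\<close> for the pigeonhole step.\<close>
  define d :: real where "d = 1 / (2 * card P)"
  have d: "0 < d" using P0 by (simp add: d_def)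
  obtain n0 where n0: "\<forall>(X :: 'a set) S. finite X \<and> n0 \<le> card X \<and> S \<subseteq> K \<rightarrow>\<^sub>E X \<and>
      d * real (card X) ^ card K \<le> card S
    \<longrightarrow> (\<exists>\<phi> \<psi>. (\<forall>k\<in>K. \<phi> k \<in> X \<and> \<psi> k \<in> X \<and> \<phi> k \<noteq> \<psi> k) \<and>
          (\<forall>A. (\<lambda>k\<in>K. if k \<in> A then \<phi> k else \<psi> k) \<in> S))"
    using dense_imp_doubled_tuple[OF K(1) d, where ?'a = 'a] ..
  show ?thesis unfolding K_def[symmetric]
  proof (intro exI[of _ n0] allI impI, elim conjE)
    fix X :: "'a set" and E \<nu>
    let ?Y = "X \<times> X \<times> X"
    let ?B = "{\<Phi> \<in> {..<m} \<rightarrow>\<^sub>E ?Y. typical_sample E \<nu> m \<Phi>}"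
    assume X: "finite X" "n0 \<le> card X" and B: "real (card ?Y) ^ m / 2 \<le> card ?B"
    define g where "g \<Phi> = {(i, j, k) \<in> K \<times> K \<times> K. {flatten m \<Phi> i, flatten m \<Phi> j, flatten m \<Phi> k} \<in> E}" for \<Phi>
    have finB: "finite ?B"
      using X by (intro finite_subset[OF _ finite_PiE[of "{..<m}" "\<lambda>_. ?Y"]]) auto
    have "g ` ?B \<subseteq> P" by (auto simp: g_def P_def)
    then obtain G where G: "real (card ?B) / card P \<le> card {\<Phi> \<in> ?B. g \<Phi> = G}"
      using pigeonhole_real[OF finB P] by blast
    define S where "S = flatten m ` {\<Phi> \<in> ?B. g \<Phi> = G}"
    have "inj_on (flatten m) {\<Phi> \<in> ?B. g \<Phi> = G}"
      by (rule inj_on_subset[OF inj_on_flatten[of m ?Y]]) auto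
    then have cS: "card S = card {\<Phi> \<in> ?B. g \<Phi> = G}" by (simp add: S_def card_image)
    have SX: "S \<subseteq> K \<rightarrow>\<^sub>E X" unfolding S_def K_def using flatten_in_PiE by blast
    have "d * real (card X) ^ card K = real (card ?Y) ^ m / 2 / card P"
    proof -
      have "real (card ?Y) ^ m = real (card X) ^ card K"
        by (simp add: K power_mult card_cartesian_product power3_eq_cube mult.assoc)
      then show ?thesis by (simp add: d_def)
    qed
    also have "\<dots> \<le> real (card ?B) / card P" using B by (intro divide_right_mono) auto
    finally have "d * real (card X) ^ card K \<le> card S" using G cS by simp
    then have "finite X \<and> n0 \<le> card X \<and> S \<subseteq> K \<rightarrow>\<^sub>E X \<and> d * real (card X) ^ card K \<le> card S"
      using X SX by (intro conjI)
    from n0[THEN spec, THEN spec, THEN mp, OF this] obtain \<phi> \<psi>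
      where \<phi>: "\<forall>k\<in>K. \<phi> k \<in> X \<and> \<psi> k \<in> X \<and> \<phi> k \<noteq> \<psi> k"
      and mix: "\<And>A. (\<lambda>k\<in>K. if k \<in> A then \<phi> k else \<psi> k) \<in> S"
      by (elim exE conjE) (rule that, assumption, drule spec)
    from mix[of UNIV] obtain \<Phi> where "\<Phi> \<in> {\<Phi> \<in> ?B. g \<Phi> = G}" unfolding S_def by (rule imageE)
    then have \<Phi>: "typical_sample E \<nu> m \<Phi>" "g \<Phi> = G" by auto
    have "{if i \<in> A then \<phi> i else \<psi> i, if j \<in> A then \<phi> j else \<psi> j,
                if k \<in> A then \<phi> k else \<psi> k} \<in> E"
      if ijk: "i \<in> K" "j \<in> K" "k \<in> K"
        and e: "{flatten m \<Phi> i, flatten m \<Phi> j, flatten m \<Phi> k} \<in> E" for i j k A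
    proof -
      \<comment> \<open>Every choice of representatives is the flattening of some sample in the same
        class, so it has the same edge pattern as \<open>\<Phi>\<close>.\<close>
      from mix[of A] obtain \<Psi> where \<Psi>: "(\<lambda>k\<in>K. if k \<in> A then \<phi> k else \<psi> k) = flatten m \<Psi>"
        "\<Psi> \<in> {\<Phi> \<in> ?B. g \<Phi> = G}" unfolding S_def by (rule imageE)
      have "(i, j, k) \<in> g \<Phi>" using e ijk by (simp add: g_def)
      also have "g \<Phi> = g \<Psi>" using \<Phi>(2) \<Psi>(2) by simp
      finally have "{flatten m \<Psi> i, flatten m \<Psi> j, flatten m \<Psi> k} \<in> E" by (simp add: g_def)
      then show ?thesis
        using ijk by (simp flip: \<Psi>(1))
    qed
    then show "\<exists>\<Phi> \<phi> \<psi>. typical_sample E \<nu> m \<Phi> \<and>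
       (\<forall>k\<in>K. \<phi> k \<in> X \<and> \<psi> k \<in> X \<and> \<phi> k \<noteq> \<psi> k) \<and>
       (\<forall>i\<in>K. \<forall>j\<in>K. \<forall>k\<in>K. {flatten m \<Phi> i, flatten m \<Phi> j, flatten m \<Phi> k} \<in> E \<longrightarrow>
          (\<forall>A. {if i \<in> A then \<phi> i else \<psi> i, if j \<in> A then \<phi> j else \<psi> j,
                if k \<in> A then \<phi> k else \<psi> k} \<in> E))"
      using \<Phi>(1) \<phi> by - (rule exI[of _ \<Phi>], rule exI[of _ \<phi>], rule exI[of _ \<psi>],
          intro conjI, assumption, assumption, blast)
  qed
qed

section \<open>Choice of constants and the contradiction\<close>

theorem mainTheorem8:
  shows "\<exists>\<epsilon>0>0. \<forall>\<epsilon>::real. 0 < \<epsilon> \<and> \<epsilon> < \<epsilon>0 \<longrightarrow>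
           (\<exists>\<theta>0>0. \<forall>\<theta>::real. 0 < \<theta> \<and> \<theta> < \<theta>0 \<longrightarrow>
             (\<exists>n0::nat. \<forall>n \<ge> n0. \<forall>(X :: 'a set) E.
                finite X \<and> card X = n \<and> is_3graph X E \<and> \<not> contains_fano X E \<and>
                real (min_codegree X E) > (1/2 - \<theta>) * real n
                \<longrightarrow> (\<exists>Z \<subseteq> X. real (card Z) > (1/2 - \<epsilon>) * real n \<and>
                       real (spanned_edges E Z) \<le> \<epsilon> * real (card Z) ^ 3 / 6)))"
proof (rule exI[of _ "1/4 :: real"], intro conjI allI impI)
  fix \<epsilon> :: real
  assume "0 < \<epsilon> \<and> \<epsilon> < 1/4"
  then have \<epsilon>: "0 < \<epsilon>" "\<epsilon> < 1/4" by auto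
  \<comment> \<open>Used both as the Chernoff deviation and as the bound on \<open>\<theta>\<close>:
    then \<open>2 * \<theta> + \<delta>\<close> stays below \<open>3 * \<epsilon> / 10000\<close>,
    well under the gain \<open>\<epsilon> / 1152\<close>.\<close>
  define \<delta> where "\<delta> = \<epsilon> / 10000"
  have \<delta>: "0 < \<delta>" "\<delta> \<le> 1" using \<epsilon> by (auto simp: \<delta>_def)
  have "0 < \<delta>\<^sup>2 / 4" using \<delta> by simp
  then obtain m :: nat where m: "20000 / \<epsilon> \<le> m" "10 \<le> m"
    "9 * (real m)\<^sup>2 * exp (- (\<delta>\<^sup>2 / 4) * real (m - 2)) \<le> 1/4"
    by (rule sample_size_exists)
  obtain n0 :: nat where n0: "\<forall>(X :: 'a set) E \<nu>. finite X \<and> n0 \<le> card X \<and>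
     real (card (X \<times> X \<times> X)) ^ m / 2 \<le> card {\<Phi> \<in> {..<m} \<rightarrow>\<^sub>E X \<times> X \<times> X. typical_sample E \<nu> m \<Phi>} \<longrightarrow>
     (\<exists>\<Phi> \<phi> \<psi>. typical_sample E \<nu> m \<Phi> \<and>
       (\<forall>k\<in>{..<m} \<times> {..<3}. \<phi> k \<in> X \<and> \<psi> k \<in> X \<and> \<phi> k \<noteq> \<psi> k) \<and>
       (\<forall>i\<in>{..<m} \<times> {..<3}. \<forall>j\<in>{..<m} \<times> {..<3}. \<forall>k\<in>{..<m} \<times> {..<3}.
          {flatten m \<Phi> i, flatten m \<Phi> j, flatten m \<Phi> k} \<in> E \<longrightarrow>
          (\<forall>A. {if i \<in> A then \<phi> i else \<psi> i, if j \<in> A then \<phi> j else \<psi> j,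
                if k \<in> A then \<phi> k else \<psi> k} \<in> E)))"
    using doubled_typical_sample[of m, where ?'a = 'a] ..
  show "\<exists>\<theta>0>0. \<forall>\<theta>::real. 0 < \<theta> \<and> \<theta> < \<theta>0 \<longrightarrow>
             (\<exists>n0::nat. \<forall>n \<ge> n0. \<forall>(X :: 'a set) E.
                finite X \<and> card X = n \<and> is_3graph X E \<and> \<not> contains_fano X E \<and>
                real (min_codegree X E) > (1/2 - \<theta>) * real n
                \<longrightarrow> (\<exists>Z \<subseteq> X. real (card Z) > (1/2 - \<epsilon>) * real n \<and>
                       real (spanned_edges E Z) \<le> \<epsilon> * real (card Z) ^ 3 / 6))"
  proof (rule exI[of _ \<delta>], intro conjI allI impI)
    show "0 < \<delta>" by fact
    fix \<theta> :: real assume "0 < \<theta> \<and> \<theta> < \<delta>"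
    then have \<theta>: "0 < \<theta>" "\<theta> < \<delta>" by auto
    show "\<exists>n0::nat. \<forall>n \<ge> n0. \<forall>(X :: 'a set) E.
                finite X \<and> card X = n \<and> is_3graph X E \<and> \<not> contains_fano X E \<and>
                real (min_codegree X E) > (1/2 - \<theta>) * real n
                \<longrightarrow> (\<exists>Z \<subseteq> X. real (card Z) > (1/2 - \<epsilon>) * real n \<and>
                       real (spanned_edges E Z) \<le> \<epsilon> * real (card Z) ^ 3 / 6)"
    \<comment> \<open>With \<open>n \<ge> 36 * m\<^sup>2\<close>, coincidences spoil at most a
      quarter of the samples; the choice of \<open>m\<close> bounds the weight failures by another
      quarter.\<close>
    proof (intro exI[of _ "max n0 (36 * m\<^sup>2)"] allI impI, elim conjE, rule ccontr)
      fix n and X :: "'a set" and E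
      assume n: "max n0 (36 * m\<^sup>2) \<le> n" and X: "finite X" "card X = n"
        and H: "is_3graph X E" "\<not> contains_fano X E"
        and codeg: "(1/2 - \<theta>) * real n < real (min_codegree X E)"
        and neg: "\<not> (\<exists>Z \<subseteq> X. real (card Z) > (1/2 - \<epsilon>) * real n \<and>
                       real (spanned_edges E Z) \<le> \<epsilon> * real (card Z) ^ 3 / 6)"
      let ?Y = "X \<times> X \<times> X"
      define \<mu> where "\<mu> = 1/2 + \<theta> - \<epsilon>/1152"
      have "0 < 36 * m\<^sup>2" using m(2) by simp
      then have npos: "0 < n" using n by linarith
      have X0: "X \<noteq> {}" using npos X by auto
      have dense: "real (spanned_edges E Z) > \<epsilon> * real (card Z) ^ 3 / 6"
        if "Z \<subseteq> X" "real (card Z) > (1/2 - \<epsilon>) * card X" for Z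
        using neg that X(2) by force
      have mean: "(\<Sum>p\<in>?Y. block_weight E (pair_nbhd E a b) p) \<le> \<mu> * card ?Y"
        if "a \<in> X" "b \<in> X" "a \<noteq> b" for a b
        unfolding \<mu>_def
      proof (rule mean_block_weight_le[OF X(1) H(1)])
        show "(1/2 - \<theta>) * card X < real (card (pair_nbhd E a b))"
          using min_codegree_le_card_pair_nbhd[OF X(1) H(1) that] codeg unfolding X(2) by linarith
      qed (use \<epsilon> \<theta> dense pair_nbhd_subset[OF H(1)] in auto)
      let ?T = "{\<Phi> \<in> {..<m} \<rightarrow>\<^sub>E ?Y. typical_sample E (\<mu> + \<delta>) m \<Phi>}"
      let ?U = "{\<Phi> \<in> {..<m} \<rightarrow>\<^sub>E ?Y. \<not> typical_sample E (\<mu> + \<delta>) m \<Phi>}"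
      have "real (36 * m\<^sup>2) \<le> real n" using n by (intro of_nat_mono) simp
      then have "9 * (real m)\<^sup>2 * (1 / n) \<le> 1/4" using npos by (simp add: field_simps)
      then have half: "9 * (real m)\<^sup>2 * (exp (- (\<delta>\<^sup>2 / 4) * real (m - 2)) + 1 / n) \<le> 1/2"
        using m(3) by (simp add: distrib_left)
      have "real (card ?U) \<le> 9 * (real m)\<^sup>2 * (exp (- (\<delta>\<^sup>2 / 4) * real (m - 2)) + 1 / card X)
          * real (card ?Y) ^ m"
        by (rule card_not_typical_sample_le[OF X(1) X0]) (use \<delta> mean in auto)
      also have "\<dots> \<le> 1/2 * real (card ?Y) ^ m"
        using half by (intro mult_right_mono) (auto simp: X(2))
      finally have U: "real (card ?U) \<le> real (card ?Y) ^ m / 2" by simp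
      have fin: "finite ({..<m} \<rightarrow>\<^sub>E ?Y)" using X by (intro finite_PiE) auto
      have "card ({..<m} \<rightarrow>\<^sub>E ?Y) = card (?T \<union> ?U)" by (rule arg_cong[of _ _ card]) auto
      also have "\<dots> = card ?T + card ?U" using fin by (intro card_Un_disjoint) auto
      finally have "real (card ?Y ^ m) = real (card ?T) + real (card ?U)"
        by (simp only: card_funcsetE[OF finite_lessThan] card_lessThan flip: of_nat_add)
      then have "real (card ?Y) ^ m / 2 \<le> card ?T" using U by simp
      moreover have "finite X \<and> n0 \<le> card X" using X n by simp
      ultimately obtain \<Phi> \<phi> \<psi> where \<Phi>: "typical_sample E (\<mu> + \<delta>) m \<Phi>"
        and \<phi>: "\<forall>k\<in>{..<m} \<times> {..<3}. \<phi> k \<in> X \<and> \<psi> k \<in> X \<and> \<phi> k \<noteq> \<psi> k"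
        and mix: "\<forall>i\<in>{..<m} \<times> {..<3}. \<forall>j\<in>{..<m} \<times> {..<3}. \<forall>k\<in>{..<m} \<times> {..<3}.
          {flatten m \<Phi> i, flatten m \<Phi> j, flatten m \<Phi> k} \<in> E \<longrightarrow>
          (\<forall>A. {if i \<in> A then \<phi> i else \<psi> i, if j \<in> A then \<phi> j else \<psi> j,
                if k \<in> A then \<phi> k else \<psi> k} \<in> E)"
        using n0[rule_format, of X E "\<mu> + \<delta>"] by blast
      obtain I where I: "I \<subseteq> {..<m} \<times> {..<3}"
        "min_codegree X E * card ({..<m} \<times> {..<3::nat}) \<le> card I * card X"
        and indep: "\<And>i j k. i \<in> I \<Longrightarrow> j \<in> I \<Longrightarrow> k \<in> I \<Longrightarrow> \<exists>A. {if i \<in> A then \<phi> i else \<psi> i,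
          if j \<in> A then \<phi> j else \<psi> j, if k \<in> A then \<phi> k else \<psi> k} \<notin> E"
        using doubled_tuple_independent_set[OF X(1) H, of "{..<m} \<times> {..<3}" \<phi> \<psi>] \<phi> by blast
      have "real (min_codegree X E * (3 * m)) \<le> real (card I * n)"
        using I(2) by (simp only: X(2) card_cartesian_product card_lessThan of_nat_le_iff mult.commute)
      then have "real (min_codegree X E) * (3 * m) \<le> card I * real n" by simp
      moreover have "(1/2 - \<theta>) * real n * (3 * m) < real (min_codegree X E) * (3 * m)"
        using codeg m(2) by (intro mult_strict_right_mono) auto
      ultimately have "((1/2 - \<theta>) * (3 * m)) * real n < card I * real n"
        by (simp add: mult_ac)
      then have cI: "(1/2 - \<theta>) * (3 * m) < card I" using npos by simp
      \<comment> \<open>With \<open>m \<ge> 10\<close> the independent set exceeds three elements,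
        hence cannot lie in one block.\<close>
      have "(1/4) * (3 * 10) \<le> (1/2 - \<theta>) * (3 * real m)"
        using \<theta> \<epsilon> m(2) by (intro mult_mono) (auto simp: \<delta>_def)
      then have "3 < card I" using cI by linarith
      moreover have "{coord c (\<Phi> s), coord c' (\<Phi> s'), coord c'' (\<Phi> s'')} \<notin> E"
        if "(s, c) \<in> I" "(s', c') \<in> I" "(s'', c'') \<in> I" for s c s' c' s'' c''
      proof
        assume "{coord c (\<Phi> s), coord c' (\<Phi> s'), coord c'' (\<Phi> s'')} \<in> E"
        moreover have K: "(s, c) \<in> {..<m} \<times> {..<3}" "(s', c') \<in> {..<m} \<times> {..<3}" "(s'', c'') \<in> {..<m} \<times> {..<3}"
          using that I(1) by blast+
        ultimately have "{flatten m \<Phi> (s, c), flatten m \<Phi> (s', c'), flatten m \<Phi> (s'', c'')} \<in> E"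
          by (simp add: flatten_def)
        then show False using mix[rule_format, OF K] indep[OF that] by blast
      qed
      ultimately have "card I \<le> 6 + 3 * ((\<mu> + \<delta>) * real (m - 2))"
        by (intro typical_sample_independent_card_le[OF \<Phi> I(1)])
      also have "(\<mu> + \<delta>) * real (m - 2) \<le> (\<mu> + \<delta>) * m"
        using \<epsilon> \<delta> \<theta> by (intro mult_left_mono) (auto simp: \<mu>_def)
      finally have "(1/2 - \<theta>) * (3 * m) < 6 + 3 * ((\<mu> + \<delta>) * m)" using cI by linarith
      \<comment> \<open>The additive \<open>6\<close> from the two exceptional blocks becomes
        \<open>2\<close> after division by \<open>3\<close>;
        \<open>m \<ge> 20000 / \<epsilon>\<close> was chosen to violate this inequality.\<close>
      then have "(\<epsilon>/1152 - 2 * \<theta> - \<delta>) * m < 2" by (simp add: \<mu>_def algebra_simps)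
      moreover have "\<epsilon> / 10000 * m \<le> (\<epsilon>/1152 - 2 * \<theta> - \<delta>) * m"
        using \<theta> \<epsilon> by (intro mult_right_mono) (auto simp: \<delta>_def)
      moreover have "2 \<le> \<epsilon> / 10000 * m" using m(1) \<epsilon> by (simp add: field_simps)
      ultimately show False by linarith
    qed
  qed
qed simp

end
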